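(* Let $U$ be a real Hilbert space, $\mathcal{F}:U\to\mathbb{R}$ and $\mathcal{G}:U\to\mathbb{R}\cup\{\infty\}$ ($\mathcal{G}$ not necessarily convex). For each $\gamma>0$ let $(u_\gamma,p_\gamma)\in U\times U$ be a solution of $$-p_\gamma\in\partial\mathcal{F}(u_\gamma),\qquad u_\gamma=H_\gamma(p_\gamma).$$ Assume: (1) $\mathcal{F}$ is convex and weakly lower semicontinuous, $\mathcal{G}$ is proper and non-negative, and $\mathcal{F}+\mathcal{G}^{**}$ is radially unbounded; (2) (i) $\mathcal{F}$ is Fréchet differentiable and $\mathcal{F}'$ has weakly closed graph, and (ii) boundedness of $\{\mathcal{F}(u_\gamma)\}_{\gamma>0}$ implies boundedness of $\{\mathcal{F}'(u_\gamma)\}_{\gamma>0}$; (3) boundedness of $\{p_\gamma\}_{\gamma>0}$ implies boundedness of $\big\{\inf_{q\in\partial\mathcal{G}^*(p_\gamma)}\|q\|_U\big\}_{\gamma>0}$. Then the family $\{(u_\gamma,p_\gamma)\}_{\gamma>0}$ contains a subsequence converging weakly, as $\gamma\to0$, to a solution $(\bar u,\bar p)\in U\times U$ of $$-\bar p\in\partial\mathcal{F}(\bar u),\qquad\bar u\in\partial\mathcal{G}^*(\bar p).$$ If $\mathcal{F}$ is strictly convex, the whole sequence converges weakly.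
   Context: $U$ is identified with its dual. $\mathcal{G}^*:U\to\mathbb{R}\cup\{\infty\}$, $\mathcal{G}^*(p)=\sup_{u\in U}\langle u,p\rangle-\mathcal{G}(u)$, is the Fenchel conjugate of $\mathcal{G}$ and $\mathcal{G}^{**}=(\mathcal{G}^* )^*$ is its biconjugate. $\partial$ denotes the convex subdifferential. A functional $\mathcal{K}$ is radially unbounded if $\mathcal{K}(u)\to\infty$ whenever $\|u\|_U\to\infty$. For $\gamma>0$, $H_\gamma:=(\partial\mathcal{G}^* )_\gamma$ is the Moreau–Yosida regularization of $\partial\mathcal{G}^*$, i.e. $H_\gamma(p)=\frac1\gamma\left(p-\mathrm{prox}_{\gamma\mathcal{G}^*}(p)\right)$ with $\mathrm{prox}_{\gamma f}(v)=\arg\min_{w\in U} f(w)+\frac1{2\gamma}\|w-v\|_U^2$. "$\mathcal{F}'$ has weakly closed graph" means: if $u_n\rightharpoonup u$ and $\mathcal{F}'(u_n)\rightharpoonup\xi$ weakly in $U$, then $\xi=\mathcal{F}'(u)$. "Subsequence converging weakly as $\gamma\to0$" means: there are $\gamma_n\to0$ such that $u_{\gamma_n}\rightharpoonup\bar u$ and $p_{\gamma_n}\rightharpoonup\bar p$ weakly in $U$; "the whole sequence converges weakly" means that $u_\gamma\rightharpoonup\bar u$ and $p_\gamma\rightharpoonup\bar p$ as $\gamma\to0$. *)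

theory Defs
  imports "HOL-Analysis.Analysis"
begin

text \<open>
  The real Hilbert space is a type of class \<open>{real_inner, complete_space}\<close>, identified with its
  dual through the inner product. Functionals with values in \<open>\<real> \<union> {\<infinity>}\<close> are functions into
  \<^typ>\<open>ereal\<close>; that \<open>-\<infinity>\<close> is not attained is part of \<open>proper\<close>.
\<close>

definition weakly_tendsto :: "('i \<Rightarrow> 'a::real_inner) \<Rightarrow> 'a \<Rightarrow> 'i filter \<Rightarrow> bool" where
  "weakly_tendsto f l F \<longleftrightarrow> (\<forall>v. ((\<lambda>i. inner (f i) v) \<longlongrightarrow> inner l v) F)"

definition proper :: "('a \<Rightarrow> ereal) \<Rightarrow> bool" where
  "proper f \<longleftrightarrow> (\<forall>u. f u \<noteq> -\<infinity>) \<and> (\<exists>u. f u \<noteq> \<infinity>)"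

definition strictly_convex :: "('a::real_vector \<Rightarrow> real) \<Rightarrow> bool" where
  "strictly_convex f \<longleftrightarrow>
    (\<forall>x y t. x \<noteq> y \<longrightarrow> 0 < t \<longrightarrow> t < 1 \<longrightarrow>
       f ((1 - t) *\<^sub>R x + t *\<^sub>R y) < (1 - t) * f x + t * f y)"

text \<open>Sequential weak lower semicontinuity, which topological weak lower semicontinuity implies
  (for convex functionals the two are equivalent).\<close>

definition weakly_lsc :: "('a::real_inner \<Rightarrow> real) \<Rightarrow> bool" where
  "weakly_lsc f \<longleftrightarrow>
    (\<forall>x u. weakly_tendsto x u sequentially \<longrightarrow> ereal (f u) \<le> liminf (\<lambda>n. ereal (f (x n))))"

definition radially_unbounded :: "('a::real_normed_vector \<Rightarrow> ereal) \<Rightarrow> bool" where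
  "radially_unbounded K \<longleftrightarrow> (K \<longlongrightarrow> \<infinity>) at_infinity"

definition conjugate :: "('a::real_inner \<Rightarrow> ereal) \<Rightarrow> 'a \<Rightarrow> ereal" where
  "conjugate f p = (SUP u. ereal (inner u p) - f u)"

text \<open>Empty at points where the functional is not finite.\<close>

definition subdifferential :: "('a::real_inner \<Rightarrow> ereal) \<Rightarrow> 'a \<Rightarrow> 'a set" where
  "subdifferential f x =
    {p. \<bar>f x\<bar> \<noteq> \<infinity> \<and> (\<forall>v. f x + ereal (inner p (v - x)) \<le> f v)}"

text \<open>\<open>ARG_MIN\<close> picks some minimizer. For \<open>\<gamma> > 0\<close> and a proper, convex, lower semicontinuous
  functional, such as the conjugate of a proper non-negative one, the minimizer exists and is
  unique.\<close>

definition prox :: "real \<Rightarrow> ('a::real_inner \<Rightarrow> ereal) \<Rightarrow> 'a \<Rightarrow> 'a" where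
  "prox \<gamma> f v = (ARG_MIN (\<lambda>w. f w + ereal (1 / (2 * \<gamma>) * (norm (w - v))\<^sup>2)) w. True)"

text \<open>The Moreau-Yosida regularization \<open>(\<partial>f)\<^sub>\<gamma>\<close> of the subdifferential of \<open>f\<close>.\<close>

definition moreau_yosida :: "real \<Rightarrow> ('a::real_inner \<Rightarrow> ereal) \<Rightarrow> 'a \<Rightarrow> 'a" where
  "moreau_yosida \<gamma> f p = (1 / \<gamma>) *\<^sub>R (p - prox \<gamma> f p)"

text \<open>The Riesz representative of the Frechet derivative. It exists and is unique wherever the
  functional is Frechet differentiable, the space being complete.\<close>

definition gradient :: "('a::real_inner \<Rightarrow> real) \<Rightarrow> 'a \<Rightarrow> 'a" where
  "gradient f u = (THE g. GDERIV f u :> g)"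

definition weakly_closed_graph :: "('a::real_inner \<Rightarrow> 'a) \<Rightarrow> bool" where
  "weakly_closed_graph T \<longleftrightarrow>
    (\<forall>x u \<xi>. weakly_tendsto x u sequentially \<longrightarrow> weakly_tendsto (\<lambda>n. T (x n)) \<xi> sequentially \<longrightarrow>
       \<xi> = T u)"

end

theory Submission
  imports Defs
begin

text \<open>
  The idea is that the regularized solutions converge in norm, so that passing to the limit only
  needs the closedness of the graph of a subdifferential in the norm topology.

  Put \<open>w \<gamma> = p \<gamma> - \<gamma> u \<gamma>\<close>. The prox problem of \<open>G\<^sup>*\<close> has a minimizer, and its optimality
  condition turns \<open>u \<gamma> = H\<^sub>\<gamma> (p \<gamma>)\<close> into \<open>u \<gamma> \<in> \<partial>G\<^sup>*(w \<gamma>)\<close>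
  (\<open>moreau_yosida_in_subdifferential\<close>). Since \<open>- p \<gamma> \<in> \<partial>F(u \<gamma>)\<close>, this makes \<open>u \<gamma>\<close> a minimizer of
  \<open>F + G\<^sup>*\<^sup>* + \<gamma>/2 \<parallel>\<cdot>\<parallel>\<^sup>2\<close>: the path \<open>\<gamma> \<mapsto> u \<gamma>\<close> is a Tikhonov regularization path.
  This has two consequences.

  Comparing with a fixed point where \<open>G\<close> is finite bounds \<open>F + G\<^sup>*\<^sup>*\<close> along the path for
  \<open>\<gamma> \<le> 1\<close>, and radial unboundedness then bounds \<open>u \<gamma>\<close>.

  Adding the monotonicity inequalities of \<open>\<partial>F\<close> and \<open>\<partial>G\<^sup>*\<close> at two parameters gives
  \<open>(\<gamma> + \<delta>) \<parallel>u \<gamma> - u \<delta>\<parallel>\<^sup>2 \<le> (\<delta> - \<gamma>) (\<parallel>u \<gamma>\<parallel>\<^sup>2 - \<parallel>u \<delta>\<parallel>\<^sup>2)\<close>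
  (\<open>resolvent_path_inequality\<close>). Hence \<open>\<parallel>u \<gamma>\<parallel>\<close> increases as \<open>\<gamma>\<close> decreases, and
  since it is bounded, \<open>u \<gamma>\<close> is Cauchy as \<open>\<gamma> \<rightarrow> 0\<close>: boundedness alone yields norm
  convergence to some \<open>ubar\<close> (\<open>resolvent_path_convergent\<close>).

  Finally, Frechet differentiability of \<open>F\<close> at \<open>ubar\<close> forces subgradients at points tending to
  \<open>ubar\<close> to converge in norm (\<open>subgradients_convergent\<close>). So \<open>p \<gamma> \<rightarrow> pbar\<close> and
  \<open>w \<gamma> \<rightarrow> pbar\<close>, and both inclusions pass to the limit. The limit is taken over all \<open>\<gamma> \<rightarrow> 0\<close>
  at once, so the whole family converges, in particular along \<open>\<gamma> = 1 / (n + 1)\<close>.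
\<close>

section \<open>Convergence in complete spaces\<close>

lemma cauchy_tendsto_ex:
  fixes f :: "'i \<Rightarrow> 'a::complete_space"
  assumes "L \<noteq> bot"
    and "\<And>e. e > 0 \<Longrightarrow> \<exists>P. eventually P L \<and> (\<forall>x y. P x \<and> P y \<longrightarrow> dist (f x) (f y) < e)"
  shows "\<exists>l. (f \<longlongrightarrow> l) L"
proof -
  have "cauchy_filter (filtermap f L)"
    using assms(2) by (simp add: cauchy_filter_metric_filtermap)
  then have "\<exists>l. filtermap f L \<le> nhds l"
    using assms(1) by (intro cauchy_filter_complete_converges[of _ UNIV] complete_UNIV)
      (auto simp: filtermap_bot_iff)
  then show ?thesis
    by (auto simp: filterlim_def)
qed

lemma tendsto_imp_weakly_tendsto: "(f \<longlongrightarrow> l) L \<Longrightarrow> weakly_tendsto f l L"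
  unfolding weakly_tendsto_def by (auto intro: tendsto_inner)

section \<open>Subgradients of real-valued functionals\<close>

lemma subdifferential_real_iff:
  "q \<in> subdifferential (\<lambda>v. ereal (F v)) x \<longleftrightarrow> (\<forall>v. F x + inner q (v - x) \<le> F v)"
  by (simp add: subdifferential_def)

lemma subdifferential_real_closed:
  assumes "L \<noteq> bot" and y: "(y \<longlongrightarrow> x) L" and q: "(q \<longlongrightarrow> qbar) L" and "isCont F x"
    and sub: "\<forall>\<^sub>F i in L. q i \<in> subdifferential (\<lambda>v. ereal (F v)) (y i)"
  shows "qbar \<in> subdifferential (\<lambda>v. ereal (F v)) x"
  unfolding subdifferential_real_iff
proof
  fix v
  have "((\<lambda>i. F (y i) + inner (q i) (v - y i)) \<longlongrightarrow> F x + inner qbar (v - x)) L"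
    using y q isCont_tendsto_compose[OF \<open>isCont F x\<close> y] by (intro tendsto_intros)
  moreover have "\<forall>\<^sub>F i in L. F (y i) + inner (q i) (v - y i) \<le> F v"
    using sub by eventually_elim (simp add: subdifferential_real_iff)
  ultimately show "F x + inner qbar (v - x) \<le> F v"
    using \<open>L \<noteq> bot\<close> by (rule tendsto_upperbound)
qed

text \<open>
  Test the subgradient inequality at \<open>y\<close> with \<open>y + t k\<close>, where \<open>\<parallel>t k\<parallel> = d/3\<close>. As both \<open>y\<close> and
  \<open>y + t k\<close> lie within distance \<open>d\<close> of \<open>x\<close>, the first-order expansion at \<open>x\<close>, with relative
  error \<open>e/6\<close>, replaces \<open>F (y + t k) - F y\<close> by \<open>t D k\<close> up to \<open>2 (e/6) d = e \<parallel>t k\<parallel>\<close>.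
\<close>

lemma subgradient_near_derivative:
  fixes F :: "'a::real_inner \<Rightarrow> real"
  assumes D: "(F has_derivative D) (at x)" and "e > 0"
  shows "\<exists>d>0. \<forall>y q. dist y x < d \<longrightarrow> q \<in> subdifferential (\<lambda>v. ereal (F v)) y \<longrightarrow>
    (\<forall>k. inner q k - D k \<le> e * norm k)"
proof -
  have lin: "linear D"
    using D by (rule has_derivative_linear)
  have "e / 6 > 0"
    using \<open>e > 0\<close> by simp
  then obtain d where "d > 0"
    and d: "\<And>z. norm (z - x) < d \<Longrightarrow> \<bar>F z - F x - D (z - x)\<bar> \<le> e / 6 * norm (z - x)"
    using D unfolding has_derivative_at_alt by (metis real_norm_def)
  have "inner q k - D k \<le> e * norm k"
    if y: "dist y x < d / 2" and q: "q \<in> subdifferential (\<lambda>v. ereal (F v)) y" for y q k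
  proof (cases "k = 0")
    case True
    then show ?thesis
      using linear_0[OF lin] by simp
  next
    case False
    define t where "t = d / (3 * norm k)"
    have t: "t > 0" "norm (t *\<^sub>R k) = d / 3" "t * norm k = d / 3"
      using False \<open>d > 0\<close> by (auto simp: t_def)
    have ny: "norm (y - x) < d / 2"
      using y by (simp add: dist_norm)
    have "norm (y + t *\<^sub>R k - x) \<le> norm (y - x) + norm (t *\<^sub>R k)"
      by (metis add_diff_eq add.commute norm_triangle_ineq diff_add_eq)
    then have nk: "norm (y + t *\<^sub>R k - x) < d"
      using t ny \<open>d > 0\<close> by simp
    have e1: "\<bar>F y - F x - D (y - x)\<bar> \<le> e / 6 * d"
      using d[of y] ny \<open>d > 0\<close> \<open>e > 0\<close>
      by (intro order_trans[OF d mult_left_mono]) auto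
    have e2: "\<bar>F (y + t *\<^sub>R k) - F x - D (y + t *\<^sub>R k - x)\<bar> \<le> e / 6 * d"
      using nk \<open>e > 0\<close> by (intro order_trans[OF d mult_left_mono]) auto
    have "D (y + t *\<^sub>R k - x) = D (y - x) + t * D k"
      using linear_add[OF lin, of "y - x" "t *\<^sub>R k"] linear_scale[OF lin, of t k]
      by (simp add: algebra_simps)
    moreover have "F y + t * inner q k \<le> F (y + t *\<^sub>R k)"
      using q[unfolded subdifferential_real_iff, rule_format, of "y + t *\<^sub>R k"] by simp
    ultimately have "t * (inner q k - D k) \<le> e * (d / 3)"
      using e1 e2 unfolding abs_le_iff by (simp add: algebra_simps)
    also have "\<dots> = t * (e * norm k)"
      using t(3) by (metis mult.left_commute)
    finally show ?thesis
      using t(1) by simp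
  qed
  then show ?thesis
    using \<open>d > 0\<close> by (intro exI[of _ "d / 2"]) auto
qed

lemma subgradients_convergent:
  fixes F :: "'a::{real_inner, complete_space} \<Rightarrow> real"
  assumes "F differentiable (at x)" and "L \<noteq> bot" and y: "(y \<longlongrightarrow> x) L"
    and sub: "\<forall>\<^sub>F i in L. q i \<in> subdifferential (\<lambda>v. ereal (F v)) (y i)"
  shows "\<exists>qbar. (q \<longlongrightarrow> qbar) L"
proof (rule cauchy_tendsto_ex[OF \<open>L \<noteq> bot\<close>])
  fix e :: real
  assume "e > 0"
  obtain D where D: "(F has_derivative D) (at x)"
    using assms(1) by (auto simp: differentiable_def)
  then have lin: "linear D"
    by (rule has_derivative_linear)
  obtain d where "d > 0"
    and d: "\<And>y q k. dist y x < d \<Longrightarrow> q \<in> subdifferential (\<lambda>v. ereal (F v)) y \<Longrightarrow>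
      inner q k - D k \<le> e / 3 * norm k"
    using subgradient_near_derivative[OF D, of "e / 3"] \<open>e > 0\<close> by auto
  define P where
    "P = (\<lambda>i. dist (y i) x < d \<and> q i \<in> subdifferential (\<lambda>v. ereal (F v)) (y i))"
  have "eventually P L"
    unfolding P_def using tendstoD[OF y \<open>d > 0\<close>] sub by (rule eventually_conj)
  moreover have "dist (q i) (q j) < e" if "P i" "P j" for i j
  proof -
    define k where "k = q i - q j"
    have "inner (q i) k - D k \<le> e / 3 * norm k" "inner (q j) (- k) - D (- k) \<le> e / 3 * norm (- k)"
      using that d unfolding P_def by blast+
    then have "inner k k \<le> 2 * e / 3 * norm k"
      by (simp add: linear_neg[OF lin] inner_diff_left[of "q i" "q j" k, folded k_def])
    then have "norm k * norm k \<le> 2 * e / 3 * norm k"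
      by (simp add: dot_square_norm power2_eq_square)
    then have "norm k \<le> 2 * e / 3"
      using \<open>e > 0\<close> by (cases "norm k = 0") (auto simp: mult_le_cancel_right)
    then show ?thesis
      using \<open>e > 0\<close> by (simp add: k_def dist_norm)
  qed
  ultimately show "\<exists>P. eventually P L \<and> (\<forall>i j. P i \<and> P j \<longrightarrow> dist (q i) (q j) < e)"
    by blast
qed

section \<open>Fenchel conjugates\<close>

lemma fenchel_young: "ereal (inner v p) - G v \<le> conjugate G p"
  unfolding conjugate_def by (rule SUP_upper) simp

text \<open>
  A conjugate is a supremum of continuous affine functions. For a proper functional only the
  points where it is real matter, so that convexity and lower semicontinuity of the conjugate become
  statements about real linear inequalities.
\<close>

lemma conjugate_le_real_iff:
  assumes "proper G"
  shows "conjugate G p \<le> ereal c \<longleftrightarrow> (\<forall>v g. G v = ereal g \<longrightarrow> inner v p - g \<le> c)"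
proof
  assume "conjugate G p \<le> ereal c"
  then have "ereal (inner v p) - G v \<le> ereal c" for v
    using fenchel_young order_trans by blast
  then show "\<forall>v g. G v = ereal g \<longrightarrow> inner v p - g \<le> c"
    by (metis ereal_less_eq(3) ereal_minus(1))
next
  assume *: "\<forall>v g. G v = ereal g \<longrightarrow> inner v p - g \<le> c"
  have "ereal (inner v p) - G v \<le> ereal c" for v
    using * assms by (cases "G v") (auto simp: proper_def)
  then show "conjugate G p \<le> ereal c"
    unfolding conjugate_def by (intro SUP_least) auto
qed

lemma conjugate_convex_combination:
  assumes "proper G" and "conjugate G x \<le> ereal a" "conjugate G y \<le> ereal b"
    and "0 \<le> t" "t \<le> 1"
  shows "conjugate G ((1 - t) *\<^sub>R x + t *\<^sub>R y) \<le> ereal ((1 - t) * a + t * b)"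
proof -
  have "inner v ((1 - t) *\<^sub>R x + t *\<^sub>R y) - g \<le> (1 - t) * a + t * b" if "G v = ereal g" for v g
  proof -
    have "inner v x - g \<le> a" "inner v y - g \<le> b"
      using assms(1-3) that by (auto simp: conjugate_le_real_iff)
    then have "(1 - t) * (inner v x - g) + t * (inner v y - g) \<le> (1 - t) * a + t * b"
      using assms(4,5) by (intro add_mono mult_left_mono) auto
    then show ?thesis
      by (simp add: inner_add_right algebra_simps)
  qed
  then show ?thesis
    using assms(1) by (simp add: conjugate_le_real_iff)
qed

lemma conjugate_lsc:
  assumes "proper G" and "L \<noteq> bot" and x: "(x \<longlongrightarrow> l) L" and a: "(a \<longlongrightarrow> c) L"
    and le: "\<forall>\<^sub>F i in L. conjugate G (x i) \<le> ereal (a i)"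
  shows "conjugate G l \<le> ereal c"
  unfolding conjugate_le_real_iff[OF \<open>proper G\<close>]
proof (intro allI impI)
  fix v g
  assume g: "G v = ereal g"
  have "((\<lambda>i. inner v (x i) - g) \<longlongrightarrow> inner v l - g) L"
    using x by (intro tendsto_intros)
  moreover have "\<forall>\<^sub>F i in L. inner v (x i) - g \<le> a i"
    using le by eventually_elim (use g \<open>proper G\<close> in \<open>auto simp: conjugate_le_real_iff\<close>)
  ultimately show "inner v l - g \<le> c"
    using \<open>L \<noteq> bot\<close> a by (intro tendsto_le)
qed

lemma conjugate_not_MInfty:
  assumes "proper G"
  shows "conjugate G p \<noteq> -\<infinity>"
proof -
  obtain v where "G v \<noteq> \<infinity>" "G v \<noteq> -\<infinity>"
    using assms by (auto simp: proper_def)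
  then show ?thesis
    using fenchel_young[of v p G] by (cases "G v") auto
qed

lemma proper_conjugate_of_nonneg:
  assumes "proper G" and "\<And>v. 0 \<le> G v"
  shows "proper (conjugate G)"
proof -
  have "0 \<le> g" if "G v = ereal g" for v g
    using assms(2)[of v] that by simp
  then have "conjugate G 0 \<le> ereal 0"
    unfolding conjugate_le_real_iff[OF assms(1)] by auto
  then have "conjugate G 0 \<noteq> \<infinity>"
    by auto
  then show ?thesis
    using conjugate_not_MInfty[OF assms(1)] by (auto simp: proper_def)
qed

text \<open>
  At a fixed test point \<open>v\<close> with \<open>G\<^sup>*(v) = b\<close>, the subgradient inequality bounds \<open>G\<^sup>*(w i)\<close> by a
  convergent real net, and lower semicontinuity carries the bound over to \<open>wbar\<close>. Properness
  provides one such \<open>v\<close>, which shows that \<open>G\<^sup>*(wbar)\<close> is finite.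
\<close>

lemma subdifferential_conjugate_closed:
  assumes "proper G" and "proper (conjugate G)" and "L \<noteq> bot"
    and w: "(w \<longlongrightarrow> wbar) L" and q: "(q \<longlongrightarrow> qbar) L"
    and sub: "\<forall>\<^sub>F i in L. q i \<in> subdifferential (conjugate G) (w i)"
  shows "qbar \<in> subdifferential (conjugate G) wbar"
proof -
  have *: "conjugate G wbar \<le> ereal (b - inner qbar (v - wbar))"
    if "conjugate G v = ereal b" for v b
  proof (rule conjugate_lsc[OF \<open>proper G\<close> \<open>L \<noteq> bot\<close> w])
    show "((\<lambda>i. b - inner (q i) (v - w i)) \<longlongrightarrow> b - inner qbar (v - wbar)) L"
      using w q by (intro tendsto_intros)
    show "\<forall>\<^sub>F i in L. conjugate G (w i) \<le> ereal (b - inner (q i) (v - w i))"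
      using sub
    proof eventually_elim
      case (elim i)
      then have "conjugate G (w i) + ereal (inner (q i) (v - w i)) \<le> ereal b"
        using that unfolding subdifferential_def by (metis (mono_tags, lifting) mem_Collect_eq)
      then show ?case
        by (cases "conjugate G (w i)") auto
    qed
  qed
  obtain v0 b0 where "conjugate G v0 = ereal b0"
    using \<open>proper (conjugate G)\<close> unfolding proper_def by (metis ereal_cases)
  then obtain c where c: "conjugate G wbar = ereal c"
    using * conjugate_not_MInfty[OF \<open>proper G\<close>, of wbar] by (cases "conjugate G wbar") fastforce+
  have "ereal c + ereal (inner qbar (v - wbar)) \<le> conjugate G v" for v
    using *[of v] c conjugate_not_MInfty[OF \<open>proper G\<close>, of v] by (cases "conjugate G v") auto
  then show ?thesis
    using c by (auto simp: subdifferential_def)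
qed

text \<open>The equality case of the Fenchel-Young inequality.\<close>

lemma biconjugate_le_of_subgradient:
  assumes "q \<in> subdifferential H w" and "H w = ereal a"
  shows "conjugate H q \<le> ereal (inner w q - a)"
  unfolding conjugate_def
proof (rule SUP_least)
  fix v
  have "ereal a + ereal (inner q (v - w)) \<le> H v"
    using assms by (auto simp: subdifferential_def)
  then show "ereal (inner v q) - H v \<le> ereal (inner w q - a)"
    by (cases "H v") (auto simp: inner_diff_right inner_commute)
qed

section \<open>The proximal problem\<close>

text \<open>
  The infimum is taken over the epigraph, where the values are real. By the parallelogram law the
  functional is uniformly convex, so a minimizing sequence is Cauchy; the affine minorant
  coming from a point where \<open>G\<close> is finite makes the infimum finite.
\<close>

lemma prox_minimizer_exists:
  fixes G :: "'a::{real_inner, complete_space} \<Rightarrow> ereal"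
  assumes "proper G" and "proper (conjugate G)" and "c > 0"
  shows "\<exists>w. \<forall>v. conjugate G w + ereal (c * (norm (w - p))\<^sup>2)
    \<le> conjugate G v + ereal (c * (norm (v - p))\<^sup>2)"
proof -
  define S where "S = {a + c * (norm (x - p))\<^sup>2 | x a. conjugate G x \<le> ereal a}"
  obtain x0 a0 where "conjugate G x0 = ereal a0"
    using \<open>proper (conjugate G)\<close> unfolding proper_def by (metis ereal_cases)
  then have "a0 + c * (norm (x0 - p))\<^sup>2 \<in> S"
    unfolding S_def by force
  then have "S \<noteq> {}"
    by blast
  obtain v0 g0 where g0: "G v0 = ereal g0"
    using \<open>proper G\<close> unfolding proper_def by (metis ereal_cases)
  have "bdd_below S"
  proof (rule bdd_belowI)
    fix s
    assume "s \<in> S"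
    then obtain x a where s: "s = a + c * (norm (x - p))\<^sup>2" and "conjugate G x \<le> ereal a"
      unfolding S_def by blast
    then have "inner v0 x - g0 \<le> a"
      using g0 \<open>proper G\<close> by (auto simp: conjugate_le_real_iff)
    moreover have "c * (norm (y + (1 / (2 * c)) *\<^sub>R v0))\<^sup>2
        = c * (norm y)\<^sup>2 + inner v0 y + (norm v0)\<^sup>2 / (4 * c)" for y
      using \<open>c > 0\<close> unfolding power2_norm_eq_inner
      by (simp add: inner_add_left inner_add_right inner_commute field_simps)
    then have "0 \<le> c * (norm (x - p))\<^sup>2 + inner v0 (x - p) + (norm v0)\<^sup>2 / (4 * c)"
      using \<open>c > 0\<close> by (metis less_imp_le mult_nonneg_nonneg zero_le_power2)
    ultimately show "inner v0 p - g0 - (norm v0)\<^sup>2 / (4 * c) \<le> s"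
      unfolding s by (simp add: inner_diff_right)
  qed
  define m where "m = Inf S"
  have m_le: "m \<le> a + c * (norm (x - p))\<^sup>2" if "conjugate G x \<le> ereal a" for x a
    unfolding m_def using that \<open>bdd_below S\<close> by (intro cInf_lower) (auto simp: S_def)
  have "\<exists>x a. conjugate G x \<le> ereal a \<and> a + c * (norm (x - p))\<^sup>2 < m + 1 / Suc n" for n
  proof -
    have "\<exists>s\<in>S. s < m + 1 / Suc n"
      using \<open>S \<noteq> {}\<close> \<open>bdd_below S\<close> unfolding m_def by (subst cInf_less_iff[symmetric]) auto
    then show ?thesis
      unfolding S_def by blast
  qed
  then obtain x a where xa: "\<And>n. conjugate G (x n) \<le> ereal (a n)"
    and lt: "\<And>n. a n + c * (norm (x n - p))\<^sup>2 < m + 1 / Suc n"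
    by metis
  have close: "c / 4 * (norm (x i - x j))\<^sup>2 \<le> (1 / Suc i + 1 / Suc j) / 2" for i j
  proof -
    define z where "z = (1 - 1/2) *\<^sub>R x i + (1/2) *\<^sub>R x j"
    have "conjugate G z \<le> ereal ((1 - 1/2) * a i + 1/2 * a j)"
      unfolding z_def using xa \<open>proper G\<close> by (intro conjugate_convex_combination) auto
    then have "m \<le> (1 - 1/2) * a i + 1/2 * a j + c * (norm (z - p))\<^sup>2"
      by (rule m_le)
    moreover have "(norm (z - p))\<^sup>2 = (norm (x i - p))\<^sup>2 / 2 + (norm (x j - p))\<^sup>2 / 2
        - (norm (x i - x j))\<^sup>2 / 4"
      unfolding z_def power2_norm_eq_inner
      by (simp add: inner_add_left inner_add_right inner_diff_left inner_diff_right
          inner_commute field_simps)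
    ultimately show ?thesis
      using lt[of i] lt[of j] by (simp add: algebra_simps)
  qed
  have "\<exists>w. x \<longlonglongrightarrow> w"
  proof (rule cauchy_tendsto_ex)
    fix e :: real
    assume "e > 0"
    define b where "b = c / 4 * e\<^sup>2"
    have "b > 0"
      using \<open>c > 0\<close> \<open>e > 0\<close> by (simp add: b_def)
    have "\<forall>\<^sub>F n in sequentially. 1 / Suc n < b"
      using order_tendstoD(2)[OF lim_1_over_n[THEN LIMSEQ_Suc] \<open>b > 0\<close>] by simp
    moreover have "dist (x i) (x j) < e" if "1 / Suc i < b" "1 / Suc j < b" for i j
    proof -
      have "c / 4 * (norm (x i - x j))\<^sup>2 < c / 4 * e\<^sup>2"
        using close[of i j] add_strict_mono[OF that] unfolding b_def[symmetric]
        by (elim le_less_trans) simp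
      then have "(norm (x i - x j))\<^sup>2 < e\<^sup>2"
        using \<open>c > 0\<close> by simp
      then show ?thesis
        using \<open>e > 0\<close> by (simp add: dist_norm power_less_imp_less_base)
    qed
    ultimately show "\<exists>P. eventually P sequentially \<and> (\<forall>i j. P i \<and> P j \<longrightarrow> dist (x i) (x j) < e)"
      by blast
  qed simp
  then obtain w where w: "x \<longlonglongrightarrow> w"
    by blast
  have "conjugate G w \<le> ereal (m - c * (norm (w - p))\<^sup>2)"
  proof (rule conjugate_lsc[OF \<open>proper G\<close> _ w])
    have "(\<lambda>n. m + 1 / Suc n - c * (norm (x n - p))\<^sup>2) \<longlonglongrightarrow> m + 0 - c * (norm (w - p))\<^sup>2"
      using w by (intro tendsto_intros lim_1_over_n[THEN LIMSEQ_Suc])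
    then show "(\<lambda>n. m + 1 / Suc n - c * (norm (x n - p))\<^sup>2) \<longlonglongrightarrow> m - c * (norm (w - p))\<^sup>2"
      by simp
    have "a n \<le> m + 1 / Suc n - c * (norm (x n - p))\<^sup>2" for n
      using lt[of n] by linarith
    then show "\<forall>\<^sub>F n in sequentially. conjugate G (x n)
        \<le> ereal (m + 1 / Suc n - c * (norm (x n - p))\<^sup>2)"
      by (intro always_eventually allI order_trans[OF xa]) simp
  qed simp
  then have "conjugate G w + ereal (c * (norm (w - p))\<^sup>2) \<le> ereal m"
    by (cases "conjugate G w") auto
  moreover have "ereal m \<le> conjugate G v + ereal (c * (norm (v - p))\<^sup>2)" for v
    using m_le[of v] conjugate_not_MInfty[OF \<open>proper G\<close>, of v] by (cases "conjugate G v") auto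
  ultimately show ?thesis
    using order_trans by blast
qed

text \<open>
  The optimality condition of the proximal problem: compare the minimizer \<open>w\<close> with
  \<open>w + t (v - w)\<close>, divide by \<open>t\<close> and let \<open>t\<close> tend to \<open>0\<close>.
\<close>

lemma moreau_yosida_in_subdifferential:
  fixes G :: "'a::{real_inner, complete_space} \<Rightarrow> ereal"
  assumes "proper G" and "proper (conjugate G)" and "\<gamma> > 0"
  shows "moreau_yosida \<gamma> (conjugate G) p
    \<in> subdifferential (conjugate G) (p - \<gamma> *\<^sub>R moreau_yosida \<gamma> (conjugate G) p)"
proof -
  define c where "c = 1 / (2 * \<gamma>)"
  define w where "w = prox \<gamma> (conjugate G) p"
  define q where "q = moreau_yosida \<gamma> (conjugate G) p"
  have "c > 0"
    using \<open>\<gamma> > 0\<close> by (simp add: c_def)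
  have q: "q = (2 * c) *\<^sub>R (p - w)"
    by (simp add: q_def w_def c_def moreau_yosida_def)
  have w': "w = p - \<gamma> *\<^sub>R q"
    using \<open>\<gamma> > 0\<close> by (simp add: q c_def)
  have min: "conjugate G w + ereal (c * (norm (w - p))\<^sup>2)
      \<le> conjugate G v + ereal (c * (norm (v - p))\<^sup>2)" for v
  proof -
    have "is_arg_min (\<lambda>w. conjugate G w + ereal (c * (norm (w - p))\<^sup>2)) (\<lambda>_. True) w"
      unfolding w_def prox_def c_def[symmetric] arg_min_def
      by (rule someI_ex) (use prox_minimizer_exists[OF assms(1,2) \<open>c > 0\<close>, of p] in
          \<open>simp add: is_arg_min_def not_less\<close>)
    then show ?thesis
      by (simp add: is_arg_min_def not_less)
  qed
  obtain v0 b0 where "conjugate G v0 = ereal b0"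
    using \<open>proper (conjugate G)\<close> unfolding proper_def by (metis ereal_cases)
  then obtain a where a: "conjugate G w = ereal a"
    using min[of v0] conjugate_not_MInfty[OF \<open>proper G\<close>, of w] by (cases "conjugate G w") auto
  have real: "a + inner q (v - w) \<le> b" if b: "conjugate G v = ereal b" for v b
  proof -
    have "a + inner q (v - w) - b \<le> t * (c * (norm (v - w))\<^sup>2)" if t: "0 < t" "t \<le> 1" for t
    proof -
      define z where "z = (1 - t) *\<^sub>R w + t *\<^sub>R v"
      have "conjugate G z \<le> ereal ((1 - t) * a + t * b)"
        unfolding z_def using a b t \<open>proper G\<close> by (intro conjugate_convex_combination) auto
      then have "ereal a + ereal (c * (norm (w - p))\<^sup>2)
          \<le> ereal ((1 - t) * a + t * b) + ereal (c * (norm (z - p))\<^sup>2)"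
        using min[of z] a by (metis add_right_mono order_trans)
      then have le: "a + c * (norm (w - p))\<^sup>2 \<le> (1 - t) * a + t * b + c * (norm (z - p))\<^sup>2"
        by simp
      have zp: "z - p = (w - p) + t *\<^sub>R (v - w)"
        by (simp add: z_def algebra_simps)
      have nz: "(norm (z - p))\<^sup>2 = (norm (w - p))\<^sup>2 + 2 * t * inner (w - p) (v - w)
          + t * t * (norm (v - w))\<^sup>2"
        unfolding zp power2_norm_eq_inner
        by (simp add: inner_add_left inner_add_right inner_commute[of "v - w" "w - p"] ring_distribs)
      have iq: "inner q (v - w) = - (2 * c * inner (w - p) (v - w))"
        by (simp add: q inner_diff_left algebra_simps)
      have "t * (a + inner q (v - w) - b) \<le> t * (t * (c * (norm (v - w))\<^sup>2))"
        using le unfolding nz iq by (simp add: algebra_simps)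
      then show ?thesis
        using t by simp
    qed
    then have "\<forall>\<^sub>F t in at_right 0. a + inner q (v - w) - b \<le> t * (c * (norm (v - w))\<^sup>2)"
      unfolding eventually_at_right_field by (intro exI[of _ 1]) auto
    moreover have "((\<lambda>t. t * (c * (norm (v - w))\<^sup>2)) \<longlongrightarrow> 0 * (c * (norm (v - w))\<^sup>2)) (at_right 0)"
      by (intro tendsto_intros)
    ultimately have "a + inner q (v - w) - b \<le> 0 * (c * (norm (v - w))\<^sup>2)"
      by (intro tendsto_lowerbound) auto
    then show ?thesis
      by simp
  qed
  have "ereal a + ereal (inner q (v - w)) \<le> conjugate G v" for v
    using real[of v] conjugate_not_MInfty[OF \<open>proper G\<close>, of v] by (cases "conjugate G v") auto
  then show ?thesis
    using a by (auto simp: subdifferential_def w'[symmetric] q_def[symmetric])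
qed

section \<open>The regularization path\<close>

lemma subdifferential_monotone:
  assumes "q \<in> subdifferential f x" and "r \<in> subdifferential f y"
  shows "0 \<le> inner (q - r) (x - y)"
proof -
  obtain a b where "f x = ereal a" "f y = ereal b"
    using assms by (fastforce simp: subdifferential_def)
  moreover have "f x + ereal (inner q (y - x)) \<le> f y" "f y + ereal (inner r (x - y)) \<le> f x"
    using assms by (auto simp: subdifferential_def)
  ultimately show ?thesis
    by (simp add: inner_diff_left inner_diff_right)
qed

text \<open>
  In the sum of the two monotonicity inequalities the unknown subgradients \<open>p \<gamma>\<close> cancel. What
  remains is \<open>0 \<le> inner (\<delta> u \<delta> - \<gamma> u \<gamma>) (u \<gamma> - u \<delta>)\<close>, rewritten by polarization.
\<close>

lemma resolvent_path_inequality: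
  fixes u p :: "real \<Rightarrow> 'a::real_inner"
  assumes "- p \<gamma> \<in> subdifferential f (u \<gamma>)" "- p \<delta> \<in> subdifferential f (u \<delta>)"
    and "u \<gamma> \<in> subdifferential h (p \<gamma> - \<gamma> *\<^sub>R u \<gamma>)" "u \<delta> \<in> subdifferential h (p \<delta> - \<delta> *\<^sub>R u \<delta>)"
  shows "(\<gamma> + \<delta>) * (norm (u \<gamma> - u \<delta>))\<^sup>2 \<le> (\<delta> - \<gamma>) * ((norm (u \<gamma>))\<^sup>2 - (norm (u \<delta>))\<^sup>2)"
  using subdifferential_monotone[OF assms(1,2)] subdifferential_monotone[OF assms(3,4)]
  unfolding power2_norm_eq_inner
  by (simp add: inner_diff_left inner_diff_right inner_commute algebra_simps)

text \<open>
  A bounded monotone real function has a limit at \<open>0\<close>. By the path inequality, oscillations of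
  \<open>u\<close> are controlled by those of \<open>\<parallel>u\<parallel>\<^sup>2\<close>.
\<close>

lemma resolvent_path_convergent:
  fixes u :: "real \<Rightarrow> 'a::{real_inner, complete_space}"
  assumes path: "\<And>\<gamma> \<delta>. 0 < \<gamma> \<Longrightarrow> 0 < \<delta> \<Longrightarrow>
      (\<gamma> + \<delta>) * (norm (u \<gamma> - u \<delta>))\<^sup>2 \<le> (\<delta> - \<gamma>) * ((norm (u \<gamma>))\<^sup>2 - (norm (u \<delta>))\<^sup>2)"
    and bound: "\<And>\<gamma>. 0 < \<gamma> \<Longrightarrow> \<gamma> \<le> 1 \<Longrightarrow> norm (u \<gamma>) \<le> B"
  shows "\<exists>ubar. (u \<longlongrightarrow> ubar) (at_right 0)"
proof (rule cauchy_tendsto_ex)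
  fix e :: real
  assume "e > 0"
  have anti: "(norm (u \<delta>))\<^sup>2 \<le> (norm (u \<gamma>))\<^sup>2" if "0 < \<gamma>" "\<gamma> \<le> \<delta>" for \<gamma> \<delta>
  proof (cases "\<gamma> = \<delta>")
    case False
    have "0 \<le> (\<gamma> + \<delta>) * (norm (u \<gamma> - u \<delta>))\<^sup>2"
      using that by simp
    also have "\<dots> \<le> (\<delta> - \<gamma>) * ((norm (u \<gamma>))\<^sup>2 - (norm (u \<delta>))\<^sup>2)"
      using that by (intro path) auto
    finally show ?thesis
      using that False by (simp add: zero_le_mult_iff)
  qed simp
  have osc: "(norm (u \<gamma> - u \<delta>))\<^sup>2 \<le> (norm (u \<gamma>))\<^sup>2 - (norm (u \<delta>))\<^sup>2" if "0 < \<gamma>" "\<gamma> \<le> \<delta>" for \<gamma> \<delta>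
  proof -
    have "(\<gamma> + \<delta>) * (norm (u \<gamma> - u \<delta>))\<^sup>2 \<le> (\<delta> - \<gamma>) * ((norm (u \<gamma>))\<^sup>2 - (norm (u \<delta>))\<^sup>2)"
      using that by (intro path) auto
    also have "\<dots> \<le> (\<gamma> + \<delta>) * ((norm (u \<gamma>))\<^sup>2 - (norm (u \<delta>))\<^sup>2)"
      using that anti[OF that] by (intro mult_right_mono) auto
    finally show ?thesis
      using that by simp
  qed
  define N where "N = (\<lambda>\<gamma>. (norm (u \<gamma>))\<^sup>2) ` {0<..1}"
  have "bdd_above N"
    unfolding N_def by (rule bdd_aboveI[of _ "B\<^sup>2"]) (auto intro!: power_mono bound)
  have "Sup N - e\<^sup>2 < Sup N"
    using \<open>e > 0\<close> by simp
  moreover have "N \<noteq> {}"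
    by (simp add: N_def)
  ultimately obtain \<delta> where \<delta>: "0 < \<delta>" "\<delta> \<le> 1" "Sup N - e\<^sup>2 < (norm (u \<delta>))\<^sup>2"
    using less_cSup_iff[OF _ \<open>bdd_above N\<close>] unfolding N_def by auto
  have close: "dist (u s) (u t) < e" if "0 < s" "s \<le> t" "t < \<delta>" for s t
  proof -
    have "(norm (u s - u t))\<^sup>2 \<le> (norm (u s))\<^sup>2 - (norm (u t))\<^sup>2"
      using that by (intro osc)
    also have "\<dots> \<le> Sup N - (norm (u \<delta>))\<^sup>2"
      using that \<delta> \<open>bdd_above N\<close> by (intro diff_mono cSup_upper anti) (auto simp: N_def)
    also have "\<dots> < e\<^sup>2"
      using \<delta> by simp
    finally show ?thesis
      using \<open>e > 0\<close> by (simp add: dist_norm power_less_imp_less_base)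
  qed
  show "\<exists>P. eventually P (at_right 0) \<and> (\<forall>x y. P x \<and> P y \<longrightarrow> dist (u x) (u y) < e)"
  proof (intro exI conjI allI impI)
    show "\<forall>\<^sub>F t in at_right 0. 0 < t \<and> t < \<delta>"
      using \<delta> unfolding eventually_at_right_field by auto
    show "dist (u s) (u t) < e" if "(0 < s \<and> s < \<delta>) \<and> (0 < t \<and> t < \<delta>)" for s t
      using that close[of s t] close[of t s] by (cases "s \<le> t") (auto simp: dist_commute)
  qed
qed simp

text \<open>
  Completing the square, \<open>inner u (v - u) \<le> \<parallel>v\<parallel>\<^sup>2 / 4\<close>, makes the bound independent of \<open>u\<close>.
\<close>

lemma resolvent_energy_bound:
  fixes u p v :: "'a::real_inner"
  assumes Fsub: "- p \<in> subdifferential (\<lambda>v. ereal (F v)) u"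
    and Hsub: "u \<in> subdifferential (conjugate G) (p - \<gamma> *\<^sub>R u)"
    and "G v = ereal g" and "\<gamma> \<ge> 0"
  shows "ereal (F u) + conjugate (conjugate G) u \<le> ereal (F v + g + \<gamma> * (norm v)\<^sup>2 / 4)"
proof -
  define w where "w = p - \<gamma> *\<^sub>R u"
  obtain a where a: "conjugate G w = ereal a"
    using Hsub by (fastforce simp: subdifferential_def w_def)
  have "conjugate (conjugate G) u \<le> ereal (inner w u - a)"
    using Hsub a by (intro biconjugate_le_of_subgradient) (auto simp: w_def)
  then have "ereal (F u) + conjugate (conjugate G) u \<le> ereal (F u) + ereal (inner w u - a)"
    by (rule add_left_mono)
  also have "\<dots> \<le> ereal (F v + g + \<gamma> * (norm v)\<^sup>2 / 4)"
  proof -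
    have "F u + inner (- p) (v - u) \<le> F v"
      using Fsub by (simp add: subdifferential_real_iff)
    moreover have "inner v w - g \<le> a"
      using fenchel_young[of v w G] a \<open>G v = ereal g\<close> by simp
    moreover have "0 \<le> \<gamma> * (norm (u - (1/2) *\<^sub>R v))\<^sup>2"
      using \<open>\<gamma> \<ge> 0\<close> by simp
    ultimately show ?thesis
      unfolding w_def power2_norm_eq_inner
      by (simp add: inner_diff_left inner_diff_right inner_commute algebra_simps)
  qed
  finally show ?thesis .
qed

lemma radially_unbounded_bounded_sublevel:
  assumes "radially_unbounded K"
  shows "\<exists>B. \<forall>u. K u \<le> ereal C \<longrightarrow> norm u \<le> B"
proof -
  have "\<forall>\<^sub>F u in at_infinity. ereal C < K u"
    using assms unfolding radially_unbounded_def by (rule order_tendstoD) simp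
  then obtain B where "\<And>u. B \<le> norm u \<Longrightarrow> ereal C < K u"
    by (auto simp: eventually_at_infinity)
  then show ?thesis
    by (meson linear not_le)
qed

section \<open>Passage to the limit\<close>

theorem proposition2p5:
  fixes F :: "'a::{real_inner, complete_space} \<Rightarrow> real"
    and G :: "'a \<Rightarrow> ereal"
    and u p :: "real \<Rightarrow> 'a"
  assumes solution: "\<And>\<gamma>. \<gamma> > 0 \<Longrightarrow> - p \<gamma> \<in> subdifferential (\<lambda>v. ereal (F v)) (u \<gamma>)"
      "\<And>\<gamma>. \<gamma> > 0 \<Longrightarrow> u \<gamma> = moreau_yosida \<gamma> (conjugate G) (p \<gamma>)"
    and F_convex: "convex_on UNIV F"
    and F_wlsc: "weakly_lsc F"
    and G_proper: "proper G"
    and G_nonneg: "\<And>v. 0 \<le> G v"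
    and radial: "radially_unbounded (\<lambda>v. ereal (F v) + conjugate (conjugate G) v)"
    and F_diff: "\<And>v. F differentiable (at v)"
    and F'_closed: "weakly_closed_graph (gradient F)"
    and F'_bounded: "bounded ((\<lambda>\<gamma>. F (u \<gamma>)) ` {0<..}) \<Longrightarrow>
      bounded ((\<lambda>\<gamma>. gradient F (u \<gamma>)) ` {0<..})"
    and G_bounded: "bounded (p ` {0<..}) \<Longrightarrow>
      \<exists>C::real. \<forall>\<gamma>>0. (INF q\<in>subdifferential (conjugate G) (p \<gamma>). ereal (norm q)) \<le> ereal C"
  shows "\<exists>ubar pbar.
    - pbar \<in> subdifferential (\<lambda>v. ereal (F v)) ubar \<and>
    ubar \<in> subdifferential (conjugate G) pbar \<and>
    (\<exists>\<gamma>s. (\<forall>n. \<gamma>s n > 0) \<and> \<gamma>s \<longlonglongrightarrow> 0 \<and>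
       weakly_tendsto (\<lambda>n. u (\<gamma>s n)) ubar sequentially \<and>
       weakly_tendsto (\<lambda>n. p (\<gamma>s n)) pbar sequentially) \<and>
    (strictly_convex F \<longrightarrow>
       weakly_tendsto u ubar (at_right 0) \<and> weakly_tendsto p pbar (at_right 0))"
proof -
  note proper = G_proper proper_conjugate_of_nonneg[OF G_proper G_nonneg]
  have H: "u \<gamma> \<in> subdifferential (conjugate G) (p \<gamma> - \<gamma> *\<^sub>R u \<gamma>)" if "\<gamma> > 0" for \<gamma>
    using moreau_yosida_in_subdifferential[OF proper that, of "p \<gamma>"] solution(2)[OF that] by simp
  obtain v0 g0 where g0: "G v0 = ereal g0"
    using G_proper unfolding proper_def by (metis ereal_cases)
  define C where "C = F v0 + g0 + (norm v0)\<^sup>2 / 4"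
  obtain B where B: "\<And>v. ereal (F v) + conjugate (conjugate G) v \<le> ereal C \<Longrightarrow> norm v \<le> B"
    using radially_unbounded_bounded_sublevel[OF radial, of C] by auto
  have "\<exists>ubar. (u \<longlongrightarrow> ubar) (at_right 0)"
  proof (rule resolvent_path_convergent)
    show "(\<gamma> + \<delta>) * (norm (u \<gamma> - u \<delta>))\<^sup>2 \<le> (\<delta> - \<gamma>) * ((norm (u \<gamma>))\<^sup>2 - (norm (u \<delta>))\<^sup>2)"
      if "0 < \<gamma>" "0 < \<delta>" for \<gamma> \<delta>
      using resolvent_path_inequality[of p \<gamma> _ u \<delta>, OF solution(1,1) H H] that by blast
    show "norm (u \<gamma>) \<le> B" if "0 < \<gamma>" "\<gamma> \<le> 1" for \<gamma>
    proof (rule B)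
      have "ereal (F (u \<gamma>)) + conjugate (conjugate G) (u \<gamma>)
          \<le> ereal (F v0 + g0 + \<gamma> * (norm v0)\<^sup>2 / 4)"
        using that g0 by (intro resolvent_energy_bound[OF solution(1) H]) auto
      also have "\<dots> \<le> ereal C"
        unfolding C_def using that by (simp add: mult_left_le_one_le)
      finally show "ereal (F (u \<gamma>)) + conjugate (conjugate G) (u \<gamma>) \<le> ereal C" .
    qed
  qed
  then obtain ubar where ubar: "(u \<longlongrightarrow> ubar) (at_right 0)"
    by blast
  have pos: "\<forall>\<^sub>F \<gamma> in at_right 0. (0::real) < \<gamma>"
    by (rule eventually_at_right_less)
  have subF: "\<forall>\<^sub>F \<gamma> in at_right 0. - p \<gamma> \<in> subdifferential (\<lambda>v. ereal (F v)) (u \<gamma>)"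
    using pos by eventually_elim (rule solution(1))
  have subH: "\<forall>\<^sub>F \<gamma> in at_right 0. u \<gamma> \<in> subdifferential (conjugate G) (p \<gamma> - \<gamma> *\<^sub>R u \<gamma>)"
    using pos by eventually_elim (rule H)
  obtain qbar where qbar: "((\<lambda>\<gamma>. - p \<gamma>) \<longlongrightarrow> qbar) (at_right 0)"
    using subgradients_convergent[OF F_diff _ ubar subF] by auto
  define pbar where "pbar = - qbar"
  have pbar: "(p \<longlongrightarrow> pbar) (at_right 0)"
    using tendsto_minus[OF qbar] by (simp add: pbar_def)
  have "isCont F ubar"
    using F_diff by (rule differentiable_imp_continuous_within)
  then have limF: "- pbar \<in> subdifferential (\<lambda>v. ereal (F v)) ubar"
    using subdifferential_real_closed[OF _ ubar qbar _ subF] by (simp add: pbar_def)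
  have "((\<lambda>\<gamma>. p \<gamma> - \<gamma> *\<^sub>R u \<gamma>) \<longlongrightarrow> pbar - 0 *\<^sub>R ubar) (at_right 0)"
    using pbar ubar by (intro tendsto_intros)
  then have limH: "ubar \<in> subdifferential (conjugate G) pbar"
    using subdifferential_conjugate_closed[OF proper _ _ ubar subH] by simp
  define s :: "nat \<Rightarrow> real" where "s = (\<lambda>n. 1 / Suc n)"
  have s: "\<forall>n. s n > 0" "s \<longlonglongrightarrow> 0"
    unfolding s_def using lim_1_over_n[THEN LIMSEQ_Suc] by auto
  then have s': "filterlim s (at_right 0) sequentially"
    by (simp add: filterlim_at order_less_imp_not_eq2)
  have "weakly_tendsto (\<lambda>n. u (s n)) ubar sequentially"
    "weakly_tendsto (\<lambda>n. p (s n)) pbar sequentially"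
    using filterlim_compose[OF ubar s'] filterlim_compose[OF pbar s']
    by (auto intro: tendsto_imp_weakly_tendsto)
  moreover have "weakly_tendsto u ubar (at_right 0)" "weakly_tendsto p pbar (at_right 0)"
    using ubar pbar by (auto intro: tendsto_imp_weakly_tendsto)
  ultimately show ?thesis
    using limF limH s by blast
qed

end
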